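(* Let $m\ge 1$ and $N\ge 1$ be integers, and consider the misère single-theater escalation game with state space $\{0,1,\dots,N\}$, escalation set $S=\{1,\dots,m\}$ and threshold at $r=0$. Then the $\mathcal{P}$-positions are exactly the states $r$ with $$r\equiv 1 \pmod{m+1}.$$ Equivalently, rung $n\in\{0,1,\dots,N\}$ (that is, the state $r=N-n$) is a $\mathcal{P}$-position if and only if $N-n\equiv 1\pmod{m+1}$.
   Context: Single-theater escalation game: fix integers $m\ge1$, $N\ge1$. It is a two-player game with alternating turns. The state space is $\{0,1,\dots,N\}$; a state $r$ is the distance to the threshold, and corresponds to the rung $n=N-r$ (so $n=0$ is the status quo and $n=N$ is the threshold). From a state $r\ge1$ the player to move must choose a step $d\in S=\{1,\dots,m\}$ with $d\le r$ and moves to $r-d$ (passing is not allowed). The state $r=0$ is terminal. Under the misère convention the player who moves to $0$ loses. Outcome classes under the misère convention: the terminal state $r=0$ is declared an $\mathcal{N}$-position. For $r\ge1$, recursively, $r$ is a $\mathcal{P}$-position (the player to move loses) if and only if every state reachable by one legal move is an $\mathcal{N}$-position, and $r$ is an $\mathcal{N}$-position if and only if some state reachable by one legal move is a $\mathcal{P}$-position. *)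

theory Defs
  imports Main "HOL-Number_Theory.Cong"
begin

definition states :: "nat \<Rightarrow> nat set" where
  "states N = {0..N}"

definition escalation_set :: "nat \<Rightarrow> nat set" where
  "escalation_set m = {1..m}"

text \<open>The guard \<open>d \<le> r\<close> keeps the truncated subtraction exact; in particular
  the state 0 has no legal move.\<close>

definition moves :: "nat \<Rightarrow> nat \<Rightarrow> nat set" where
  "moves m r = {r - d | d. d \<in> escalation_set m \<and> d \<le> r}"

lemma moves_less: "s \<in> moves m r \<Longrightarrow> s < r"
  by (auto simp: moves_def escalation_set_def)

text \<open>Misere outcome classes: declaring the terminal state 0 an N-position (the player
  to move there wins) encodes that whoever moves to 0 loses. The recursion does not mention the
  bound \<open>N\<close>, since a move from a state in \<open>{0..N}\<close> stays in \<open>{0..N}\<close>.\<close>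

function is_P :: "nat \<Rightarrow> nat \<Rightarrow> bool" and is_N :: "nat \<Rightarrow> nat \<Rightarrow> bool" where
  "is_P m r \<longleftrightarrow> r \<ge> 1 \<and> (\<forall>s \<in> moves m r. is_N m s)"
| "is_N m r \<longleftrightarrow> r = 0 \<or> (\<exists>s \<in> moves m r. is_P m s)"
  by pat_completeness auto
termination
  by (relation "measure (case_sum snd snd)") (auto dest: moves_less)

(* unconditional recursive equations: they would make the simplifier loop *)
declare is_P.simps [simp del] is_N.simps [simp del]

definition P_positions :: "nat \<Rightarrow> nat \<Rightarrow> nat set" where
  "P_positions m N = {r \<in> states N. is_P m r}"

definition state_of_rung :: "nat \<Rightarrow> nat \<Rightarrow> nat" where
  "state_of_rung N n = N - n"

end

theory Submission
  imports Defs
begin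

text \<open>The misere game from state \<open>r \<ge> 1\<close> is ordinary subtraction from \<open>r - 1\<close>: moving to 0 loses,
  so the state 1 behaves as the last square of the ordinary game, and the player who keeps
  \<open>r - 1\<close> divisible by \<open>m + 1\<close> wins. Two facts carry the argument. A step of length between
  1 and \<open>m\<close> never connects two states in the same residue class modulo \<open>m + 1\<close>
  (lemma \<open>move_leaves_class\<close>), so the class of 1 cannot be kept. From every other state
  \<open>r \<ge> 1\<close>, the step \<open>(r - 1) mod (m + 1)\<close> is legal and enters that class
  (lemma \<open>move_into_class\<close>). Strong induction on \<open>r\<close> turns this into the description
  of the P-positions in \<open>is_P_iff_dvd\<close>.\<close>

lemma mem_moves_iff: "s \<in> moves m r \<longleftrightarrow> s < r \<and> r \<le> s + m"
proof
  assume "s < r \<and> r \<le> s + m"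
  then have "s = r - (r - s)" "r - s \<in> escalation_set m" "r - s \<le> r"
    by (auto simp: escalation_set_def)
  then show "s \<in> moves m r"
    unfolding moves_def by blast
qed (auto simp: moves_def escalation_set_def)

text \<open>The two mutually recursive predicates are complementary: their clauses are dual to each
  other, and the two declarations at the terminal state are opposite. This allows the recursion to
  be stated for \<open>is_P\<close> alone.\<close>

lemma is_N_iff_not_is_P: "is_N m r \<longleftrightarrow> \<not> is_P m r"
proof (induction r rule: less_induct)
  case (less r)
  then have "is_N m s \<longleftrightarrow> \<not> is_P m s" if "s \<in> moves m r" for s
    using that by (blast dest: moves_less)
  then show ?case
    by (subst is_N.simps, subst is_P.simps) auto
qed

lemma is_P_rec: "is_P m r \<longleftrightarrow> r \<ge> 1 \<and> (\<forall>s \<in> moves m r. \<not> is_P m s)"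
  by (subst is_P.simps) (simp add: is_N_iff_not_is_P)

text \<open>Otherwise \<open>m + 1\<close> would divide the length \<open>r - s\<close> of the step, which lies strictly
  between 0 and \<open>m + 1\<close>.\<close>

lemma move_leaves_class:
  assumes "s \<in> moves m r" and "1 \<le> s" and "m + 1 dvd r - 1"
  shows "\<not> m + 1 dvd s - 1"
proof
  assume "m + 1 dvd s - 1"
  with assms(3) have "m + 1 dvd (r - 1) - (s - 1)"
    by (rule dvd_diff_nat)
  moreover have "(r - 1) - (s - 1) = r - s"
    using assms(2) by simp
  ultimately have "m + 1 dvd r - s"
    by simp
  moreover have "0 < r - s" and "r - s < m + 1"
    using assms(1) by (auto simp: mem_moves_iff)
  ultimately show False
    using nat_dvd_not_less by blast
qed

text \<open>The winning reply removes the remainder of \<open>r - 1\<close>, which is positive because \<open>r - 1\<close>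
  is not a multiple of \<open>m + 1\<close>, and never reaches 0 because it is at most \<open>r - 1\<close>.\<close>

lemma move_into_class:
  assumes "1 \<le> r" and "\<not> m + 1 dvd r - 1"
  obtains s where "s \<in> moves m r" and "1 \<le> s" and "m + 1 dvd s - 1"
proof
  define d where "d = (r - 1) mod (m + 1)"
  have "0 < d"
    using assms(2) unfolding d_def by (simp add: mod_greater_zero_iff_not_dvd)
  moreover have "d \<le> m"
    using mod_less_divisor[of "m + 1" "r - 1"] unfolding d_def by linarith
  moreover have "d \<le> r - 1"
    unfolding d_def by (rule mod_less_eq_dividend)
  ultimately show "r - d \<in> moves m r" and "1 \<le> r - d"
    using assms(1) by (auto simp: mem_moves_iff)
  have "m + 1 dvd (r - 1) - d"
    unfolding d_def by (rule dvd_minus_mod)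
  then show "m + 1 dvd (r - d) - 1"
    by (simp add: diff_commute)
qed

text \<open>The condition \<open>1 \<le> r\<close> is separate because truncated subtraction gives \<open>0 - 1 = 0\<close>, a
  multiple of \<open>m + 1\<close>, whereas the terminal state is an N-position.\<close>

lemma is_P_iff_dvd: "is_P m r \<longleftrightarrow> 1 \<le> r \<and> m + 1 dvd r - 1"
proof (induction r rule: less_induct)
  case (less r)
  have "is_P m r \<longleftrightarrow> 1 \<le> r \<and> (\<forall>s \<in> moves m r. \<not> (1 \<le> s \<and> m + 1 dvd s - 1))"
    using less by (subst is_P_rec) (blast dest: moves_less)
  also have "\<dots> \<longleftrightarrow> 1 \<le> r \<and> m + 1 dvd r - 1"
    using move_leaves_class move_into_class by metis
  finally show ?case .
qed

text \<open>The hypothesis \<open>1 \<le> m\<close> rules out the terminal state: modulo 1, the state 0 would be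
  congruent to 1 without being a P-position.\<close>

lemma is_P_iff_cong:
  assumes "1 \<le> m"
  shows "is_P m r \<longleftrightarrow> [r = 1] (mod (m + 1))"
proof (cases "r = 0")
  case True
  with assms show ?thesis
    by (simp add: is_P_iff_dvd cong_def)
next
  case False
  then have "[r = 1] (mod (m + 1)) \<longleftrightarrow> m + 1 dvd r - 1"
    by (intro cong_altdef_nat) simp
  with False show ?thesis
    by (simp add: is_P_iff_dvd)
qed

theorem theorem4p1:
  fixes m N :: nat
  assumes "m \<ge> 1" and "N \<ge> 1"
  shows "P_positions m N = {r \<in> states N. [r = 1] (mod (m + 1))} \<and>
    (\<forall>n \<in> {0..N}. state_of_rung N n \<in> P_positions m N \<longleftrightarrow> [N - n = 1] (mod (m + 1)))"
  using assms(1) by (simp add: P_positions_def is_P_iff_cong state_of_rung_def states_def)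

end
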